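(* Let $\mathcal{A}$ be a complex unital $*$-algebra with tracial state $\tau$, and let $x,y,z,x',y',z'\in\mathcal{A}$ be order-$3$ unitaries. Write $x_i=\Pi_i(x)$ for $i\in\mathbb{Z}_3$, and similarly for the other variables. Then $$\sum_{i,j\in\mathbb{Z}_3}\|[x_i,y_j']\|_\tau^2\le 6240\sum_{i\in\mathbb{Z}_3}\Bigl(\|x_iy_i\|_\tau^2+\|y_iz_i\|_\tau^2+\|z_ix_i\|_\tau^2+\|x_i'y_i'\|_\tau^2+\|y_i'z_i'\|_\tau^2+\|z_i'x_i'\|_\tau^2+\|x_ix_i'\|_\tau^2+\|y_iy_i'\|_\tau^2+\|z_iz_i'\|_\tau^2\Bigr).$$
   Context: An order-$3$ unitary is $u$ with $u^*u=uu^*=1$ and $u^3=1$. For such $u$ and $a\in\mathbb{Z}_3=\{0,1,2\}$, $\Pi_a(u)=\frac13\sum_{n=0}^{2}\omega^{-na}u^n$ with $\omega=e^{2\pi i/3}$ (the spectral projection for eigenvalue $\omega^a$). $\|a\|_\tau=\sqrt{\tau(a^*a)}$ and $[a,b]=ab-ba$. A tracial state is a positive unital hermitian linear functional with $\tau(ab)=\tau(ba)$. *)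

theory Defs
  imports "HOL-Library.Nonpos_Ints" Complex_Main
begin

text \<open>The carrier is the whole type \<open>'a\<close>. The class \<open>ring_1\<close> excludes the zero ring, which
  carries no unital functional and hence no state.\<close>

locale complex_star_algebra = vector_space scale
  for scale :: "complex \<Rightarrow> 'a::ring_1 \<Rightarrow> 'a" +
  fixes star :: "'a \<Rightarrow> 'a"
  assumes scale_mult_left: "scale c a * b = scale c (a * b)"
    and scale_mult_right: "a * scale c b = scale c (a * b)"
    and star_add: "star (a + b) = star a + star b"
    and star_scale: "star (scale c a) = scale (cnj c) (star a)"
    and star_mult: "star (a * b) = star b * star a"
    and star_star: "star (star a) = a"

locale tracial_state = complex_star_algebra scale star
  for scale :: "complex \<Rightarrow> 'a::ring_1 \<Rightarrow> 'a" and star :: "'a \<Rightarrow> 'a" +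
  fixes \<tau> :: "'a \<Rightarrow> complex"
  assumes linear: "Vector_Spaces.linear scale (*) \<tau>"
    and unital: "\<tau> 1 = 1"
    and hermitian: "\<tau> (star a) = cnj (\<tau> a)"
    and positive: "\<tau> (star a * a) \<in> \<real>\<^sub>\<ge>\<^sub>0"
    and tracial: "\<tau> (a * b) = \<tau> (b * a)"

definition order3_unitary :: "('a::ring_1 \<Rightarrow> 'a) \<Rightarrow> 'a \<Rightarrow> bool" where
  "order3_unitary star u \<longleftrightarrow> star u * u = 1 \<and> u * star u = 1 \<and> u ^ 3 = 1"

definition omega :: complex where
  "omega = exp (2 * complex_of_real pi * \<i> / 3)"

text \<open>\<open>\<int>\<^sub>3\<close> is represented by the naturals \<open>{0, 1, 2} = {..<3}\<close>; the projection depends only on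
  \<open>a mod 3\<close>.\<close>

definition spec_proj :: "(complex \<Rightarrow> 'a::ring_1 \<Rightarrow> 'a) \<Rightarrow> nat \<Rightarrow> 'a \<Rightarrow> 'a" where
  "spec_proj scale a u =
     scale (1 / 3) (\<Sum>n = 0..2. scale (omega powi (- (int n * int a))) (u ^ n))"

text \<open>For a state, \<open>\<tau> (star a * a)\<close> is a nonnegative real, so \<open>Re\<close> is only a coercion.\<close>

definition tau_norm :: "('a::ring_1 \<Rightarrow> 'a) \<Rightarrow> ('a \<Rightarrow> complex) \<Rightarrow> 'a \<Rightarrow> real" where
  "tau_norm star \<tau> a = sqrt (Re (\<tau> (star a * a)))"

definition commutator :: "'a::ring_1 \<Rightarrow> 'a \<Rightarrow> 'a" where
  "commutator a b = a * b - b * a"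

end

theory Submission imports Defs begin

text \<open>
  Write \<open>R(u,v) = 1 + u v\<^sup>* + u\<^sup>* v = 3 \<Sum>\<^sub>i u\<^sub>i v\<^sub>i\<close>; its squared trace norm is nine times the defect of
  the edge \<open>uv\<close>. The identity \<open>u R(u,v) - v R(u,v)\<^sup>* = u\<^sup>* v\<^sup>* - v\<^sup>* u\<^sup>*\<close> shows that adjacent unitaries
  almost commute. The squared norm of \<open>x + y + z\<close> is three times the total defect of its triangle,
  and likewise for \<open>x' + y' + z'\<close>. Summing \<open>R(v,v') v'\<^sup>* = v\<^sup>* + v'\<^sup>* + v v'\<close> over the three rungs makes
  \<open>x x' + y y' + z z'\<close> small. Its commutator with \<open>x\<close> is approximately
  \<open>y [x, y'] + z [x, z'] \<approx> (y - z) [x, y']\<close>, and \<open>(y - z)\<^sup>* (y - z) \<approx> 3\<close>, so \<open>[x, y']\<close> is small.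
\<close>

definition edge :: "('a::ring_1 \<Rightarrow> 'a) \<Rightarrow> 'a \<Rightarrow> 'a \<Rightarrow> 'a" where
  "edge star u v = 1 + u * star v + star u * v"

lemma commutator_swap: "commutator a b = - commutator b a"
  by (simp add: commutator_def)

lemma prism_commutator_identity:
  fixes x y z x' y' z' :: "'a::ring_1"
  shows "(y - z) * commutator x y' =
      commutator x (x * x' + y * y' + z * z') - x * commutator x x'
      - commutator x y * y' - commutator x z * z'
      - z * commutator x (x' + y' + z') + z * commutator x x'"
  by (simp add: commutator_def algebra_simps)

section \<open>The primitive cube root of unity\<close>

lemma inverse_omega_cube: "inverse omega ^ 3 = 1"
proof -
  have "omega ^ 3 = exp (of_nat 3 * (2 * complex_of_real pi * \<i> / 3))"
    by (simp only: omega_def exp_of_nat_mult)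
  also have "of_nat 3 * (2 * complex_of_real pi * \<i> / 3) = 2 * complex_of_real pi * \<i>"
    by simp
  finally have "omega ^ 3 = 1" by (simp only: exp_two_pi_i)
  then show ?thesis by (simp add: power_inverse)
qed

lemma inverse_omega_neq_1: "inverse omega \<noteq> 1"
proof
  assume "inverse omega = 1"
  then have "omega = 1" by (metis inverse_inverse_eq inverse_1)
  moreover have "Re omega = cos (2 * pi / 3)"
    by (simp add: omega_def Re_exp)
  ultimately show False by (simp add: cos_120)
qed

lemma inverse_omega_sum: "1 + inverse omega + (inverse omega)\<^sup>2 = 0"
proof -
  have "(inverse omega - 1) * (1 + inverse omega + (inverse omega)\<^sup>2) = inverse omega ^ 3 - 1"
    by (simp add: power2_eq_square power3_eq_cube algebra_simps)
  then show ?thesis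
    using inverse_omega_cube inverse_omega_neq_1 by simp
qed

lemma norm_inverse_omega: "norm (inverse omega) = 1"
  by (simp add: omega_def norm_inverse)

section \<open>The trace seminorm\<close>

context tracial_state
begin

abbreviation N :: "'a \<Rightarrow> real" where "N \<equiv> tau_norm star \<tau>"

lemma star_one: "star 1 = 1"
  by (metis star_mult star_star mult_1_right)

lemma star_zero: "star 0 = 0"
  using star_add[of 0 0] by simp

lemma star_minus: "star (- a) = - star a"
  using star_add[of a "- a"] star_zero by (simp add: eq_neg_iff_add_eq_0 add.commute)

lemma star_diff: "star (a - b) = star a - star b"
  using star_add[of a "- b"] by (simp add: star_minus)

lemma tau_add: "\<tau> (a + b) = \<tau> a + \<tau> b"
  using linear by (simp add: Vector_Spaces.linear_iff)

lemma tau_scale: "\<tau> (scale c a) = c * \<tau> a"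
  using linear by (simp add: Vector_Spaces.linear_iff)

lemma scale_3: "scale 3 a = 3 * a"
proof -
  have "scale (1 + 1 + 1) a = (1 + 1 + 1) * a"
    by (simp only: scale_left_distrib distrib_right scale_one mult_1_left)
  then show ?thesis by simp
qed

lemma tau_minus: "\<tau> (- a) = - \<tau> a"
  using tau_scale[of "- 1" a] by simp

lemma tau_3: "\<tau> 3 = 3"
  using tau_add[of "1 + 1" 1] tau_add[of 1 1] by (simp add: unital)

lemma tau_square_nonneg: "0 \<le> Re (\<tau> (star a * a))"
  using positive[of a] by (auto elim: nonneg_Reals_cases)

lemma N_nonneg: "0 \<le> N a"
  by (simp add: tau_norm_def tau_square_nonneg)

lemma N_square: "(N a)\<^sup>2 = Re (\<tau> (star a * a))"
  by (simp add: tau_norm_def tau_square_nonneg)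

lemma N_eqI: "\<tau> (star a * a) = \<tau> (star b * b) \<Longrightarrow> N a = N b"
  by (simp add: tau_norm_def)

lemma N_scale: "N (scale c a) = norm c * N a"
proof -
  have "star (scale c a) * scale c a = scale (of_real ((norm c)\<^sup>2)) (star a * a)"
    by (simp add: star_scale scale_mult_left scale_mult_right complex_norm_square mult.commute
        del: of_real_power)
  then have "(N (scale c a))\<^sup>2 = (norm c * N a)\<^sup>2"
    by (simp add: N_square tau_scale power_mult_distrib del: of_real_power)
  then show ?thesis
    by (simp add: N_nonneg)
qed

lemma N_minus: "N (- a) = N a"
  by (simp add: tau_norm_def star_minus)

lemma N_star: "N (star a) = N a"
  by (rule N_eqI) (simp only: star_star tracial[of a])

lemma Re_tau_star_swap: "Re (\<tau> (star b * a)) = Re (\<tau> (star a * b))"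
  using hermitian[of "star a * b"] by (simp add: star_mult star_star)

lemma N_add_scale_square:
  "(N (a + scale (of_real t) b))\<^sup>2 = (N a)\<^sup>2 + 2 * t * Re (\<tau> (star a * b)) + t\<^sup>2 * (N b)\<^sup>2"
proof -
  have "star (a + scale (of_real t) b) * (a + scale (of_real t) b)
      = star a * a + scale (of_real t) (star a * b) + scale (of_real t) (star b * a)
        + scale (of_real t) (scale (of_real t) (star b * b))"
    by (simp add: star_add star_scale scale_mult_left scale_mult_right algebra_simps)
  then show ?thesis
    using Re_tau_star_swap[of b a]
    by (simp only: N_square tau_add tau_scale) (simp add: power2_eq_square algebra_simps)
qed

text \<open>Discriminant argument: the squared seminorm of \<open>a + t b\<close> is a nonnegative
  quadratic in real \<open>t\<close>. It degenerates to an affine function when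
  \<open>N b = 0\<close>, which can happen for nonzero \<open>b\<close>.\<close>

lemma tau_Cauchy_Schwarz: "Re (\<tau> (star a * b)) \<le> N a * N b"
proof -
  let ?r = "Re (\<tau> (star a * b))"
  have nonneg: "0 \<le> (N a)\<^sup>2 + 2 * t * ?r + t\<^sup>2 * (N b)\<^sup>2" for t
    by (simp flip: N_add_scale_square)
  have "?r\<^sup>2 \<le> (N a * N b)\<^sup>2"
  proof (cases "N b = 0")
    case True
    have "?r = 0"
    proof (rule ccontr)
      assume "?r \<noteq> 0"
      \<comment> \<open>This \<open>t\<close> makes the affine function equal to -1.\<close>
      then show False
        using nonneg[of "- ((N a)\<^sup>2 + 1) / (2 * ?r)"] True by (simp add: field_simps)
    qed
    then show ?thesis by simp
  next
    case False
    \<comment> \<open>Evaluation at the minimiser of the quadratic.\<close>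
    then have "(N a)\<^sup>2 + 2 * (- ?r / (N b)\<^sup>2) * ?r + (- ?r / (N b)\<^sup>2)\<^sup>2 * (N b)\<^sup>2
        = (N a)\<^sup>2 - ?r\<^sup>2 / (N b)\<^sup>2"
      by (simp add: field_simps power2_eq_square)
    then have "?r\<^sup>2 / (N b)\<^sup>2 \<le> (N a)\<^sup>2"
      using nonneg[of "- ?r / (N b)\<^sup>2"] by linarith
    then show ?thesis
      using False by (simp add: pos_divide_le_eq power_mult_distrib)
  qed
  then show ?thesis
    by (rule power2_le_imp_le) (simp add: N_nonneg)
qed

lemma N_triangle: "N (a + b) \<le> N a + N b"
proof (rule power2_le_imp_le)
  show "(N (a + b))\<^sup>2 \<le> (N a + N b)\<^sup>2"
    using N_add_scale_square[of a 1 b] tau_Cauchy_Schwarz[of a b]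
    by (simp add: power2_sum)
qed (simp add: N_nonneg)

lemma N_triangle_diff: "N (a - b) \<le> N a + N b"
  using N_triangle[of a "- b"] by (simp add: N_minus)

section \<open>Words in order-3 unitaries\<close>

lemma star_order3: "order3_unitary star u \<Longrightarrow> star u = u * u"
  unfolding order3_unitary_def power3_eq_cube by (metis mult.assoc mult_1_left mult_1_right)

text \<open>Together with \<open>star_order3\<close> these rules reduce words to positive powers;
  the second one fires inside right-nested products.\<close>

lemma order3_cancel:
  assumes "order3_unitary star u"
  shows "u * (u * u) = 1" and "u * (u * (u * a)) = a"
proof -
  show "u * (u * u) = 1"
    using assms by (simp add: order3_unitary_def power3_eq_cube mult.assoc)
  then show "u * (u * (u * a)) = a"
    by (metis mult.assoc mult_1_left)
qed

lemma order3_unitary_star: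
  assumes "order3_unitary star u"
  shows "order3_unitary star (star u)"
proof -
  have "star u ^ 3 = 1"
    by (simp add: star_order3[OF assms] order3_cancel[OF assms] power3_eq_cube mult.assoc)
  then show ?thesis
    using assms by (simp add: order3_unitary_def star_star)
qed

lemma N_unitary_left: "order3_unitary star u \<Longrightarrow> N (u * a) = N a"
  by (rule N_eqI) (simp add: star_mult star_order3 order3_cancel mult.assoc)

text \<open>Follows from left invariance, since traciality makes the seminorm invariant under
  \<open>star\<close>.\<close>

lemma N_unitary_right:
  assumes "order3_unitary star u"
  shows "N (a * u) = N a"
  using N_unitary_left[OF order3_unitary_star[OF assms], of "star a"]
  by (metis N_star star_mult)

lemma N_commutator_le: "order3_unitary star u \<Longrightarrow> N (commutator u a) \<le> 2 * N a"
  using N_triangle_diff[of "u * a" "a * u"]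
  by (simp add: commutator_def N_unitary_left N_unitary_right)

lemma N_commutator_star:
  assumes "order3_unitary star u"
  shows "N (commutator (star u) a) = N (commutator u a)"
proof -
  have "u * commutator (star u) a * u = - commutator u a"
    using assms by (simp add: commutator_def star_order3 order3_cancel algebra_simps)
  then show ?thesis
    using assms by (metis N_minus N_unitary_left N_unitary_right)
qed

lemma N_commutator_swap: "N (commutator a b) = N (commutator b a)"
  unfolding commutator_swap[of a b] by (rule N_minus)

lemma N_commutator_edge:
  assumes u: "order3_unitary star u" and v: "order3_unitary star v"
  shows "N (commutator u v) \<le> 2 * N (edge star u v)"
proof -
  \<comment> \<open>Since \<open>u * u = star u\<close> and \<open>v * v = star v\<close>, both
    products contain \<open>u + v\<close>, which cancels.\<close>
  have "u * edge star u v - v * star (edge star u v) = - star (commutator u v)"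
    using u v by (simp add: edge_def commutator_def star_add star_diff star_mult star_star star_one
        star_order3 order3_cancel algebra_simps)
  then have "N (commutator u v) = N (u * edge star u v - v * star (edge star u v))"
    by (simp add: N_minus N_star)
  also have "\<dots> \<le> 2 * N (edge star u v)"
    using N_triangle_diff[of "u * edge star u v" "v * star (edge star u v)"]
    by (simp add: N_unitary_left u v N_star)
  finally show ?thesis .
qed

text \<open>The nine words of the expanded square have only three distinct traces, each occurring
  three times.\<close>

lemma N_edge_square:
  assumes u: "order3_unitary star u" and v: "order3_unitary star v"
  shows "(N (edge star u v))\<^sup>2 = 3 * Re (1 + \<tau> (u * star v) + \<tau> (star u * v))"
proof -
  have "star (edge star u v) * edge star u v
      = 1 + 1 + 1 + u * star v + star v * u + v * u * v
        + star u * v + v * star u + star v * (star u * star v)"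
    using u v by (simp add: edge_def star_add star_mult star_star star_one
        star_order3 order3_cancel algebra_simps)
  moreover have "\<tau> (star v * u) = \<tau> (u * star v)" "\<tau> (v * star u) = \<tau> (star u * v)"
    by (rule tracial)+
  moreover have "\<tau> (v * u * v) = \<tau> (u * star v)"
    using v tracial[of v "u * v"] by (simp add: star_order3 mult.assoc)
  moreover have "\<tau> (star v * (star u * star v)) = \<tau> (star u * v)"
    using v tracial[of "star v" "star u * star v"] by (simp add: star_order3 order3_cancel mult.assoc)
  ultimately show ?thesis
    by (simp add: N_square tau_add tau_3 unital)
qed

text \<open>The three diagonal terms of the square supply the constant 1 of each edge; the cross
  terms supply its two traces.\<close>

lemma N_triangle_sum_square:
  assumes "order3_unitary star x" "order3_unitary star y" "order3_unitary star z"
  shows "3 * (N (x + y + z))\<^sup>2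
    = (N (edge star x y))\<^sup>2 + (N (edge star y z))\<^sup>2 + (N (edge star z x))\<^sup>2"
proof -
  have "star (x + y + z) * (x + y + z)
     = star x * x + star y * y + star z * z + star x * y + star y * x
      + star y * z + star z * y + star z * x + star x * z"
    by (simp add: star_add algebra_simps)
  then have "star (x + y + z) * (x + y + z)
     = 1 + 1 + 1 + star x * y + star y * x
      + star y * z + star z * y + star z * x + star x * z"
    using assms by (simp add: order3_unitary_def)
  then have "\<tau> (star (x + y + z) * (x + y + z))
     = 3 + \<tau> (star x * y) + \<tau> (x * star y)
      + \<tau> (star y * z) + \<tau> (y * star z) + \<tau> (star z * x) + \<tau> (z * star x)"
    using tracial[of "star y" x] tracial[of "star z" y] tracial[of "star x" z]
    by (simp add: tau_add tau_3 unital)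
  then show ?thesis
    unfolding N_edge_square[OF assms(1,2)] N_edge_square[OF assms(2,3)]
      N_edge_square[OF assms(3,1)] unfolding N_square by simp
qed

section \<open>Spectral projections\<close>

lemma spec_proj_eq:
  "spec_proj scale i u
    = scale (1 / 3) (1 + scale (inverse omega ^ i) u
        + scale (inverse omega ^ i) (scale (inverse omega ^ i) (u * u)))"
proof -
  have powi: "omega powi - (int n * int i) = inverse omega ^ (n * i)" for n
    unfolding of_nat_mult[symmetric] power_int_minus power_int_of_nat power_inverse ..
  have "{0..2::nat} = {0, 1, 2}"
    by auto
  then show ?thesis
    unfolding spec_proj_def powi by (simp add: mult_2 power_add power2_eq_square add.assoc)
qed

text \<open>Absorbs the phase into the unitary, so that every spectral projection has the form
  \<open>(1 + w + w * w) / 3\<close> with \<open>w\<close> again of order 3.\<close>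

lemma order3_unitary_scale:
  assumes u: "order3_unitary star u" and c: "c ^ 3 = 1" "norm c = 1"
  shows "order3_unitary star (scale c u)"
proof -
  have "cnj c * c = 1"
    using c(2) complex_norm_square[of c] by (simp add: mult.commute)
  then show ?thesis
    using u c(1) by (simp add: order3_unitary_def star_scale scale_mult_left scale_mult_right
        power3_eq_cube mult.commute mult.assoc)
qed

lemma spec_proj_projection:
  assumes "order3_unitary star u"
  shows "star (spec_proj scale i u) = spec_proj scale i u"
    and "spec_proj scale i u * spec_proj scale i u = spec_proj scale i u"
proof -
  define w where "w = scale (inverse omega ^ i) u"
  have "(inverse omega ^ i) ^ 3 = 1"
    using inverse_omega_cube by (metis power_mult mult.commute power_one)
  moreover have "norm (inverse omega ^ i) = 1"
    by (simp only: norm_power norm_inverse_omega power_one)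
  ultimately have w: "order3_unitary star w"
    unfolding w_def using assms by (intro order3_unitary_scale)
  have eq: "spec_proj scale i u = scale (1 / 3) (1 + w + w * w)"
    by (simp add: spec_proj_eq w_def scale_mult_left scale_mult_right)
  show "star (spec_proj scale i u) = spec_proj scale i u"
    using w by (simp add: eq star_scale star_add star_one star_mult star_order3 order3_cancel
        mult.assoc add.assoc add.commute)
  have "(1 + w + w * w) * (1 + w + w * w) = scale 3 (1 + w + w * w)"
    using w scale_left_distrib[of 1 1] scale_left_distrib[of 2 1]
    by (simp add: order3_cancel algebra_simps)
  then show "spec_proj scale i u * spec_proj scale i u = spec_proj scale i u"
    by (simp add: eq scale_mult_left scale_mult_right)
qed

text \<open>For projections p, q traciality turns the squared seminorm of \<open>p * q\<close> into
  the trace of \<open>p * q\<close>. Orthogonality of characters then leaves the traces found in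
  \<open>N_edge_square\<close>.\<close>

lemma N_edge_spec_proj:
  assumes u: "order3_unitary star u" and v: "order3_unitary star v"
  shows "(N (edge star u v))\<^sup>2 = 9 * (\<Sum>i<3. (N (spec_proj scale i u * spec_proj scale i v))\<^sup>2)"
proof -
  let ?w = "inverse omega"
  have N: "(N (spec_proj scale i u * spec_proj scale i v))\<^sup>2
      = Re (\<tau> (spec_proj scale i u * spec_proj scale i v))" for i
  proof -
    let ?p = "spec_proj scale i u" and ?q = "spec_proj scale i v"
    have "(N (?p * ?q))\<^sup>2 = Re (\<tau> (?q * (?p * ?q)))"
      using spec_proj_projection[OF u, of i] spec_proj_projection[OF v, of i]
      unfolding N_square star_mult by (metis mult.assoc)
    also have "\<tau> (?q * (?p * ?q)) = \<tau> (?p * ?q)"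
      using spec_proj_projection[OF v, of i] tracial[of ?q "?p * ?q"] by (simp add: mult.assoc)
    finally show ?thesis .
  qed
  have tau: "9 * \<tau> (spec_proj scale i u * spec_proj scale i v)
     = 1 + ?w ^ i * (\<tau> u + \<tau> v) + (?w ^ i)\<^sup>2 * (\<tau> (u * u) + \<tau> (v * v) + \<tau> (u * v))
       + (?w ^ i) ^ 3 * (\<tau> (u * star v) + \<tau> (star u * v)) + (?w ^ i) ^ 4 * \<tau> (star u * star v)" for i
    using u v by (simp add: spec_proj_eq scale_mult_left scale_mult_right tau_add tau_scale unital
        star_order3 algebra_simps power2_eq_square power3_eq_cube power4_eq_xxxx)
  have w3: "?w * ?w * ?w = 1" and w2: "?w * ?w = - 1 - ?w"
    using inverse_omega_cube inverse_omega_sum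
    by (simp_all add: power3_eq_cube power2_eq_square eq_neg_iff_add_eq_0 algebra_simps)
  \<comment> \<open>Over i = 0, 1, 2 the phases with exponents i, 2i and 4i sum to zero; those with
    exponents 0 and 3i sum to 3.\<close>
  have "9 * (\<Sum>i<3. \<tau> (spec_proj scale i u * spec_proj scale i v))
     = 3 * (1 + \<tau> (u * star v) + \<tau> (star u * v))"
    unfolding sum_distrib_left tau
    using w2 w3
    by (simp add: numeral_3_eq_3 power2_eq_square) algebra
  from arg_cong[OF this, of Re]
  have "9 * (\<Sum>i<3. Re (\<tau> (spec_proj scale i u * spec_proj scale i v)))
     = 3 * Re (1 + \<tau> (u * star v) + \<tau> (star u * v))"
    by simp
  then show ?thesis
    unfolding N_edge_square[OF u v] N by simp
qed

text \<open>Of the three averaged powers, 1 commutes with \<open>b\<close>, while \<open>u\<close>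
  and \<open>star u\<close> have commutators of equal seminorm; hence the factor 2/3.\<close>

lemma N_commutator_spec_proj:
  assumes "order3_unitary star u"
  shows "N (commutator (spec_proj scale i u) b) \<le> 2 / 3 * N (commutator u b)"
proof -
  let ?c = "inverse omega ^ i"
  have c: "norm ?c = 1"
    by (simp only: norm_power norm_inverse_omega power_one)
  have "commutator (spec_proj scale i u) b
    = scale (1 / 3) (scale ?c (commutator u b) + scale (?c * ?c) (commutator (star u) b))"
    using assms by (simp add: spec_proj_eq commutator_def scale_mult_left scale_mult_right
        star_order3 algebra_simps)
  then have "N (commutator (spec_proj scale i u) b)
    = 1 / 3 * N (scale ?c (commutator u b) + scale (?c * ?c) (commutator (star u) b))"
    by (simp add: N_scale)
  also have "\<dots> \<le> 1 / 3 * (N (commutator u b) + N (commutator (star u) b))"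
    using N_triangle[of "scale ?c (commutator u b)" "scale (?c * ?c) (commutator (star u) b)"] c
    by (simp add: N_scale norm_mult)
  finally show ?thesis
    using assms by (simp add: N_commutator_star)
qed

lemma N_commutator_spec_proj2:
  assumes u: "order3_unitary star u" and v: "order3_unitary star v"
  shows "N (commutator (spec_proj scale i u) (spec_proj scale j v)) \<le> 4 / 9 * N (commutator u v)"
  using N_commutator_spec_proj[OF u, of i "spec_proj scale j v"]
    N_commutator_spec_proj[OF v, of j u]
    N_commutator_swap[of u v] N_commutator_swap[of u "spec_proj scale j v"]
  by linarith

section \<open>The prism estimate\<close>

lemma edge_mult_star:
  assumes "order3_unitary star u" "order3_unitary star v"
  shows "edge star u v * star v = star u + star v + u * v"
  using assms by (simp add: edge_def star_order3 order3_cancel algebra_simps)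

text \<open>Here \<open>s\<close> stands for the square root of the total defect: an edge has
  seminorm at most 3s, and a triangle sum at most \<surd>3 s, rounded up to 2s.\<close>

lemma prism_commutator_bound:
  assumes o: "order3_unitary star x" "order3_unitary star y" "order3_unitary star z"
      "order3_unitary star x'" "order3_unitary star y'" "order3_unitary star z'"
    and s: "N (edge star x y) \<le> 3 * s" "N (edge star y z) \<le> 3 * s" "N (edge star z x) \<le> 3 * s"
      "N (edge star x x') \<le> 3 * s" "N (edge star y y') \<le> 3 * s" "N (edge star z z') \<le> 3 * s"
    and t: "N (x + y + z) \<le> 2 * s" "N (x' + y' + z') \<le> 2 * s"
  shows "N (commutator x y') \<le> 42 * s"
proof -
  let ?K = "commutator x y'"
  define Q where "Q = x * x' + y * y' + z * z'"
  define W where "W = 1 + star y * z + star z * y"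
  have Q_eq: "Q = edge star x x' * star x' + edge star y y' * star y' + edge star z z' * star z'
      - star (x + y + z) - star (x' + y' + z')"
    using o by (simp add: Q_def edge_mult_star star_add)
  have "N Q \<le> N (edge star x x' * star x') + N (edge star y y' * star y')
      + N (edge star z z' * star z') + N (star (x + y + z)) + N (star (x' + y' + z'))"
    unfolding Q_eq
    by (intro order_trans[OF N_triangle_diff] order_trans[OF N_triangle] add_mono order_refl)
  \<comment> \<open>Three rungs and two triangle sums: 3 * 3 + 2 * 2.\<close>
  also have "\<dots> \<le> 13 * s"
    unfolding N_star o[THEN order3_unitary_star, THEN N_unitary_right] using s t by linarith
  finally have Q: "N Q \<le> 13 * s" .
  have comm: "N (commutator x x') \<le> 6 * s" "N (commutator x y) \<le> 6 * s"
    "N (commutator x z) \<le> 6 * s" "N (commutator z y) \<le> 6 * s"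
    using N_commutator_edge[of x x'] N_commutator_edge[of x y] N_commutator_edge[of z x]
      N_commutator_edge[of y z] N_commutator_swap[of x z] N_commutator_swap[of z y] o s
    by linarith+
  \<comment> \<open>The Leibniz rule isolates \<open>y [x, y'] + z [x, z']\<close>; the triangle sum
    \<open>x' + y' + z'\<close> then trades \<open>[x, z']\<close> for
    \<open>- [x, y']\<close>.\<close>
  have yzK_eq: "(y - z) * ?K = commutator x Q - x * commutator x x' - commutator x y * y'
      - commutator x z * z' - z * commutator x (x' + y' + z') + z * commutator x x'"
    unfolding Q_def by (rule prism_commutator_identity)
  have "N ((y - z) * ?K) \<le> N (commutator x Q) + N (x * commutator x x') + N (commutator x y * y')
      + N (commutator x z * z') + N (z * commutator x (x' + y' + z')) + N (z * commutator x x')"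
    unfolding yzK_eq
    by (intro order_trans[OF N_triangle_diff] order_trans[OF N_triangle] add_mono order_refl)
  \<comment> \<open>2 * 13 from \<open>Q\<close>, 4 * 6 from adjacent commutators, 2 * 2 from the
    triangle sum.\<close>
  also have "\<dots> \<le> 54 * s"
    using Q t comm N_commutator_le[OF o(1), of Q] N_commutator_le[OF o(1), of "x' + y' + z'"]
    unfolding o[THEN N_unitary_left] o[THEN N_unitary_right] by linarith
  finally have yzK: "N ((y - z) * ?K) \<le> 54 * s" .
  have "W = edge star y z + commutator (star z) y"
    by (simp add: W_def edge_def commutator_def)
  then have W: "N W \<le> 9 * s"
    using N_triangle[of "edge star y z" "commutator (star z) y"] N_commutator_star[OF o(3)] s comm
    by simp
  \<comment> \<open>\<open>W\<close> is the error in the approximation of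
    \<open>star (y - z) * (y - z)\<close> by 3.\<close>
  have "star (y - z) * (y - z) + W = 1 + 1 + 1"
    using o by (simp add: W_def star_diff order3_unitary_def algebra_simps)
  then have "scale 3 ?K = (star (y - z) * (y - z) + W) * ?K"
    by (simp add: scale_3)
  moreover have "(star (y - z) * (y - z) + W) * k
      = star y * ((y - z) * k) - star z * ((y - z) * k) + W * k" for k
    by (simp add: star_diff left_diff_distrib distrib_right mult.assoc)
  \<comment> \<open>The seminorm is not submultiplicative, so \<open>W * ?K\<close> is split into
    two terms in which \<open>W\<close> meets only unitaries on its right.\<close>
  moreover have "W * ?K = W * x * y' - W * y' * x"
    by (simp add: commutator_def right_diff_distrib mult.assoc)
  ultimately have K_eq: "scale 3 ?K = star y * ((y - z) * ?K) - star z * ((y - z) * ?K)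
      + (W * x * y' - W * y' * x)"
    by metis
  have "3 * N ?K = N (scale 3 ?K)"
    by (simp add: N_scale)
  also have "N (scale 3 ?K) \<le> N (star y * ((y - z) * ?K)) + N (star z * ((y - z) * ?K))
      + (N (W * x * y') + N (W * y' * x))"
    unfolding K_eq
    by (intro order_trans[OF N_triangle_diff] order_trans[OF N_triangle] add_mono order_refl)
  \<comment> \<open>2 * 54 + 2 * 9.\<close>
  also have "\<dots> \<le> 126 * s"
    unfolding o[THEN N_unitary_right] o[THEN order3_unitary_star, THEN N_unitary_left]
    using yzK W by linarith
  finally show ?thesis by simp
qed

text \<open>The prism estimate with \<open>s = sqrt D\<close>, where \<open>D\<close> is the total
  defect, transferred to spectral projections. The constant is 9 * (4/9 * 42)^2 = 3136.\<close>

lemma prism_spec_proj_bound: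
  fixes x y z x' y' z' :: 'a
  assumes o: "order3_unitary star x" "order3_unitary star y" "order3_unitary star z"
      "order3_unitary star x'" "order3_unitary star y'" "order3_unitary star z'"
  defines "d \<equiv> \<lambda>u v. \<Sum>i<3. (N (spec_proj scale i u * spec_proj scale i v))\<^sup>2"
  shows "(\<Sum>i<3. \<Sum>j<3. (N (commutator (spec_proj scale i x) (spec_proj scale j y')))\<^sup>2)
    \<le> 3136 * (d x y + d y z + d z x + d x' y' + d y' z' + d z' x' + d x x' + d y y' + d z z')"
    (is "?L \<le> 3136 * ?D")
proof -
  define D where "D = ?D"
  have d: "0 \<le> d u v" for u v
    unfolding d_def by (intro sum_nonneg zero_le_power2)
  then have D: "0 \<le> D"
    unfolding D_def by (intro add_nonneg_nonneg)
  have edge: "(N (edge star u v))\<^sup>2 = 9 * d u v"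
    if "order3_unitary star u" "order3_unitary star v" for u v
    unfolding d_def by (rule N_edge_spec_proj) (rule that)+
  have edge_le: "N (edge star u v) \<le> 3 * sqrt D"
    if "order3_unitary star u" "order3_unitary star v" "d u v \<le> D" for u v
  proof (rule power2_le_imp_le)
    have "(3 * sqrt D)\<^sup>2 = 9 * D"
      unfolding power_mult_distrib real_sqrt_pow2[OF D] by simp
    then show "(N (edge star u v))\<^sup>2 \<le> (3 * sqrt D)\<^sup>2"
      using edge[OF that(1,2)] that(3) by linarith
    show "0 \<le> 3 * sqrt D"
      using real_sqrt_ge_zero[OF D] by linarith
  qed
  have sum_le: "N (u + v + w) \<le> 2 * sqrt D"
    if "order3_unitary star u" "order3_unitary star v" "order3_unitary star w"
      "d u v + d v w + d w u \<le> D" for u v w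
  proof (rule power2_le_imp_le)
    have "(2 * sqrt D)\<^sup>2 = 4 * D"
      unfolding power_mult_distrib real_sqrt_pow2[OF D] by simp
    \<comment> \<open>The square equals three times the triangle's defect, hence is at most 3 D
      \<le> 4 D.\<close>
    then show "(N (u + v + w))\<^sup>2 \<le> (2 * sqrt D)\<^sup>2"
      using N_triangle_sum_square[OF that(1-3)] edge[OF that(1,2)] edge[OF that(2,3)]
        edge[OF that(3,1)] that(4) D by linarith
    show "0 \<le> 2 * sqrt D"
      using real_sqrt_ge_zero[OF D] by linarith
  qed
  have K: "N (commutator x y') \<le> 42 * sqrt D"
    \<comment> \<open>What remains is that a single defect, or the three of one triangle, is at most
      \<open>D\<close>; this holds because all nine are nonnegative.\<close>
    by (rule prism_commutator_bound[OF o]; (rule edge_le sum_le; (rule o)?))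
      (use d[of x y] d[of y z] d[of z x] d[of x' y'] d[of y' z'] d[of z' x']
        d[of x x'] d[of y y'] d[of z z'] in \<open>simp add: D_def\<close>)+
  have "N (commutator (spec_proj scale i x) (spec_proj scale j y')) \<le> 56 / 3 * sqrt D" for i j
    using N_commutator_spec_proj2[of x y' i j] o K by linarith
  then have "(N (commutator (spec_proj scale i x) (spec_proj scale j y')))\<^sup>2
      \<le> (56 / 3 * sqrt D)\<^sup>2" for i j
    by (intro power_mono N_nonneg)
  then have "?L \<le> (\<Sum>i<3::nat. \<Sum>j<3::nat. (56 / 3 * sqrt D)\<^sup>2)"
    by (intro sum_mono)
  also have "\<dots> = 9 * (56 / 3 * sqrt D)\<^sup>2"
    by simp
  also have "\<dots> = 3136 * D"
    unfolding power_mult_distrib real_sqrt_pow2[OF D] by (simp add: power2_eq_square)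
  finally show ?thesis
    unfolding D_def .
qed

end

theorem lemma8p4:
  fixes scale :: "complex \<Rightarrow> 'a::ring_1 \<Rightarrow> 'a"
    and star :: "'a \<Rightarrow> 'a"
    and \<tau> :: "'a \<Rightarrow> complex"
    and x y z x' y' z' :: 'a
  assumes "tracial_state scale star \<tau>"
    and "order3_unitary star x" and "order3_unitary star y" and "order3_unitary star z"
    and "order3_unitary star x'" and "order3_unitary star y'" and "order3_unitary star z'"
  defines "P \<equiv> spec_proj scale"
    and "N \<equiv> tau_norm star \<tau>"
  shows "(\<Sum>i<3. \<Sum>j<3. (N (commutator (P i x) (P j y')))\<^sup>2)
    \<le> 6240 * (\<Sum>i<3.
          (N (P i x * P i y))\<^sup>2 + (N (P i y * P i z))\<^sup>2 + (N (P i z * P i x))\<^sup>2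
        + (N (P i x' * P i y'))\<^sup>2 + (N (P i y' * P i z'))\<^sup>2 + (N (P i z' * P i x'))\<^sup>2
        + (N (P i x * P i x'))\<^sup>2 + (N (P i y * P i y'))\<^sup>2 + (N (P i z * P i z'))\<^sup>2)"
proof -
  interpret tracial_state scale star \<tau> by fact
  let ?d = "\<lambda>u v. \<Sum>i<3. (N (P i u * P i v))\<^sup>2"
  let ?D = "?d x y + ?d y z + ?d z x + ?d x' y' + ?d y' z' + ?d z' x' + ?d x x' + ?d y y' + ?d z z'"
  have "(\<Sum>i<3. \<Sum>j<3. (N (commutator (P i x) (P j y')))\<^sup>2) \<le> 3136 * ?D"
    unfolding P_def N_def using assms(2-7) by (rule prism_spec_proj_bound)
  \<comment> \<open>The total defect is nonnegative, so the constant may be enlarged.\<close>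
  also have "\<dots> \<le> 6240 * ?D"
    by (intro mult_right_mono add_nonneg_nonneg sum_nonneg) auto
  finally show ?thesis
    by (simp only: sum.distrib)
qed

end
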